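(* Let $\Gamma_1,\dots,\Gamma_t$ ($t\ge2$) be finite simple non-complete graphs such that $\mathrm{Dom}(\Gamma_i)\neq\emptyset$ for all $i=1,\dots,t$. Then $$\gamma_t\Bigl(\Gamma_1\otimes\cdots\otimes\Gamma_t\setminus\bigl(\mathrm{Dom}(\Gamma_1)\times\cdots\times\mathrm{Dom}(\Gamma_t)\bigr)\Bigr)\le\min_{1\le i\le t}\gamma\bigl(\Gamma_i\setminus\mathrm{Dom}(\Gamma_i)\bigr)+1.$$ Moreover, if $\gamma_t(\Gamma_i\setminus\mathrm{Dom}(\Gamma_i))>\gamma(\Gamma_i\setminus\mathrm{Dom}(\Gamma_i))$ for each $i$, then $$\gamma_t\Bigl(\Gamma_1\otimes\cdots\otimes\Gamma_t\setminus\bigl(\mathrm{Dom}(\Gamma_1)\times\cdots\times\mathrm{Dom}(\Gamma_t)\bigr)\Bigr)=\min_{1\le i\le t}\gamma\bigl(\Gamma_i\setminus\mathrm{Dom}(\Gamma_i)\bigr)+1.$$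
   Context: For a finite simple graph $\Gamma$ with vertex set $V$, $\mathrm{Dom}(\Gamma)$ is the set of vertices adjacent to every other vertex of $\Gamma$. For $S\subseteq V$, $\Gamma\setminus S$ denotes the induced subgraph on $V\setminus S$. A dominating set of $\Gamma$ is a subset $X\subseteq V$ such that every vertex of $V\setminus X$ is adjacent to some vertex of $X$; $\gamma(\Gamma)$ is the minimum cardinality of a dominating set. A total dominating set is a subset $S\subseteq V$ such that every $v\in V$ is adjacent to some $u\in S$; $\gamma_t(\Gamma)$ is the minimum cardinality of a total dominating set. The strong product $\Gamma_1\otimes\cdots\otimes\Gamma_t$ has vertex set $V(\Gamma_1)\times\cdots\times V(\Gamma_t)$, and two distinct tuples are adjacent if and only if in every coordinate $i$ their entries are equal or adjacent in $\Gamma_i$. *)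

theory Defs
  imports "Graph_Theory.Kuratowski" "HOL-Library.Extended_Nat" "HOL-Library.FuncSet"
begin

text \<open>
  Finite simple graphs are rendered by the locale \<^locale>\<open>graph\<close>: finite, loop-free, symmetric
  digraphs without parallel arcs, where \<open>u \<rightarrow>\<^bsub>G\<^esub> v\<close> is adjacency and
  \<open>G \<restriction> S\<close> is the subgraph induced by \<open>S\<close>.
\<close>

definition Dom :: "('a, 'b) pre_digraph \<Rightarrow> 'a set" where
  "Dom G = {u \<in> verts G. \<forall>v \<in> verts G. v \<noteq> u \<longrightarrow> u \<rightarrow>\<^bsub>G\<^esub> v}"

definition remove_verts :: "('a, 'b) pre_digraph \<Rightarrow> 'a set \<Rightarrow> ('a, 'b) pre_digraph"
    (infixl \<open>\<setminus>\<close> 66) where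
  "G \<setminus> S = G \<restriction> (verts G - S)"

definition dominating_set :: "('a, 'b) pre_digraph \<Rightarrow> 'a set \<Rightarrow> bool" where
  "dominating_set G X \<longleftrightarrow> X \<subseteq> verts G \<and> (\<forall>v \<in> verts G - X. \<exists>u \<in> X. v \<rightarrow>\<^bsub>G\<^esub> u)"

definition total_dominating_set :: "('a, 'b) pre_digraph \<Rightarrow> 'a set \<Rightarrow> bool" where
  "total_dominating_set G S \<longleftrightarrow> S \<subseteq> verts G \<and> (\<forall>v \<in> verts G. \<exists>u \<in> S. v \<rightarrow>\<^bsub>G\<^esub> u)"

text \<open>
  The minimum cardinalities are taken in \<^typ>\<open>enat\<close>, so that a graph without any total dominating
  set (equivalently, one with an isolated vertex) has total domination number \<open>\<infinity>\<close>. Since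
  \<^typ>\<open>enat\<close> is well-ordered, the infimum is attained whenever a set of the required kind exists.
  Finiteness only guards against \<open>card X = 0\<close> for infinite \<open>X\<close>; it is automatic in finite graphs.
\<close>

definition domination_number :: "('a, 'b) pre_digraph \<Rightarrow> enat" (\<open>\<gamma>\<close>) where
  "\<gamma> G = (INF X \<in> {X. finite X \<and> dominating_set G X}. enat (card X))"

definition total_domination_number :: "('a, 'b) pre_digraph \<Rightarrow> enat" (\<open>\<gamma>\<^sub>t\<close>) where
  "\<gamma>\<^sub>t G = (INF S \<in> {S. finite S \<and> total_dominating_set G S}. enat (card S))"

text \<open>
  A tuple indexed by \<open>I\<close> is an extensional function on \<open>I\<close>, as in \<^const>\<open>PiE\<close>.
\<close>

definition strong_product :: "'i set \<Rightarrow> ('i \<Rightarrow> ('a, 'b) pre_digraph)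
    \<Rightarrow> ('i \<Rightarrow> 'a, ('i \<Rightarrow> 'a) \<times> ('i \<Rightarrow> 'a)) pre_digraph" where
  "strong_product I \<Gamma> = with_proj
     \<lparr> pverts = (\<Pi>\<^sub>E i\<in>I. verts (\<Gamma> i)),
       parcs = {(f, g). f \<in> (\<Pi>\<^sub>E i\<in>I. verts (\<Gamma> i)) \<and> g \<in> (\<Pi>\<^sub>E i\<in>I. verts (\<Gamma> i)) \<and> f \<noteq> g \<and>
                        (\<forall>i\<in>I. f i = g i \<or> f i \<rightarrow>\<^bsub>\<Gamma> i\<^esub> g i)} \<rparr>"

lemma graph_strong_product:
  assumes "finite I" and G: "\<And>i. i \<in> I \<Longrightarrow> graph (\<Gamma> i)"
  shows "graph (strong_product I \<Gamma>)"
proof -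
  let ?V = "\<Pi>\<^sub>E i\<in>I. verts (\<Gamma> i)"
  let ?P = "strong_product I \<Gamma>"
  have "finite (verts (\<Gamma> i))" if "i \<in> I" for i
    using G[OF that] by (simp add: graph_def digraph_def fin_digraph.finite_verts)
  then have V: "finite ?V" using assms(1) by (intro finite_PiE)
  have sym: "v \<rightarrow>\<^bsub>\<Gamma> i\<^esub> u" if "i \<in> I" "u \<rightarrow>\<^bsub>\<Gamma> i\<^esub> v" for i u v
    using G[OF that(1)] that(2)
    by (meson arcs_ends_symmetric graph_def pseudo_graph_def sym_digraph.sym_arcs)
  have "finite (arcs ?P)"
    by (rule finite_subset[OF _ finite_cartesian_product[OF V V]])
       (auto simp: strong_product_def)
  moreover have "symmetric ?P"
    unfolding symmetric_def strong_product_def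
    by (intro symI) (use sym in \<open>fastforce\<close>)
  ultimately show ?thesis
    using V by unfold_locales (auto simp: strong_product_def arc_to_ends_def)
qed

end

theory Submission
  imports Defs
begin

text \<open>
  Write \<open>D i\<close> for \<open>Dom (\<Gamma> i)\<close>, \<open>H i\<close> for \<open>\<Gamma> i \<setminus> D i\<close>, and \<open>P\<close> for the strong product without the
  tuples all of whose entries are in \<open>D\<close>.

  Upper bound. Fix a tuple \<open>d\<close> with all entries in \<open>D\<close> and a dominating set \<open>X\<close> of \<open>H i\<close>. An entry
  of \<open>d\<close> never obstructs adjacency, so every vertex of \<open>P\<close> is equal or adjacent to one of the tuples
  \<open>d(i := x)\<close> with \<open>x \<in> X\<close>. Such a tuple may have no neighbour among the others, but they all have
  a common neighbour \<open>d(j := y)\<close> with \<open>j \<noteq> i\<close> and \<open>y \<notin> D j\<close>, where \<open>y\<close> exists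
  because \<open>\<Gamma> j\<close> is not complete. Adding this one vertex makes the set
  total dominating (\<open>total_dominating_set_strong_product\<close>).

  Lower bound. Let \<open>S\<close> be a total dominating set of \<open>P\<close>. For some coordinate \<open>i\<close> the entries of
  \<open>S\<close> at \<open>i\<close> outside \<open>D i\<close> dominate \<open>H i\<close>
  (\<open>total_dominating_set_strong_product_projection\<close>), whence \<open>\<gamma> (H i) \<le> card S\<close>. If this
  projection loses a vertex, the inequality is strict. If it loses none, it turns neighbours in \<open>S\<close>
  into neighbours in \<open>H i\<close>, so the projection is even total dominating and
  \<open>\<gamma> (H i) < \<gamma>\<^sub>t (H i) \<le> card S\<close>. Either way \<open>\<gamma> (H i) + 1 \<le> card S\<close>.
\<close>

section \<open>Adjacency and dominating vertices\<close>

lemma verts_remove_verts [simp]: "verts (G \<setminus> S) = verts G - S"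
  by (simp add: remove_verts_def)

lemma adj_remove_verts [simp]:
  "u \<rightarrow>\<^bsub>G \<setminus> S\<^esub> v \<longleftrightarrow> u \<rightarrow>\<^bsub>G\<^esub> v \<and> u \<in> verts G - S \<and> v \<in> verts G - S"
  by (auto simp: remove_verts_def arcs_ends_conv)

lemma verts_strong_product [simp]: "verts (strong_product I \<Gamma>) = (\<Pi>\<^sub>E i\<in>I. verts (\<Gamma> i))"
  by (simp add: strong_product_def)

lemma adj_strong_product [simp]:
  "f \<rightarrow>\<^bsub>strong_product I \<Gamma>\<^esub> g \<longleftrightarrow>
     f \<in> (\<Pi>\<^sub>E i\<in>I. verts (\<Gamma> i)) \<and> g \<in> (\<Pi>\<^sub>E i\<in>I. verts (\<Gamma> i)) \<and> f \<noteq> g \<and>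
     (\<forall>i\<in>I. f i = g i \<or> f i \<rightarrow>\<^bsub>\<Gamma> i\<^esub> g i)"
  by (auto simp: strong_product_def arcs_ends_conv)

lemma Dom_subset_verts: "Dom G \<subseteq> verts G"
  by (auto simp: Dom_def)

lemma adj_from_Dom: "d \<in> Dom G \<Longrightarrow> v \<in> verts G \<Longrightarrow> v \<noteq> d \<Longrightarrow> d \<rightarrow>\<^bsub>G\<^esub> v"
  by (simp add: Dom_def)

lemma eq_or_adj_Dom:
  assumes "graph G" "d \<in> Dom G" "v \<in> verts G"
  shows "v = d \<or> v \<rightarrow>\<^bsub>G\<^esub> d"
proof -
  interpret graph G by fact
  show ?thesis
    using adj_from_Dom[OF assms(2,3)] arcs_ends_symmetric[OF sym_arcs] by blast
qed

lemma non_complete_imp_non_Dom: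
  assumes "graph G" "\<not> K\<^bsub>card (verts G)\<^esub> G"
  shows "verts G - Dom G \<noteq> {}"
proof
  assume "verts G - Dom G = {}"
  then have all: "u \<rightarrow>\<^bsub>G\<^esub> v" if "u \<in> verts G" "v \<in> verts G" "u \<noteq> v" for u v
    using that by (auto simp: Dom_def)
  interpret graph G by fact
  have "arcs_ends G = {(u, v). (u, v) \<in> verts G \<times> verts G \<and> u \<noteq> v}"
  proof (intro set_eqI iffI)
    fix e assume "e \<in> arcs_ends G"
    then show "e \<in> {(u, v). (u, v) \<in> verts G \<times> verts G \<and> u \<noteq> v}"
      using adj_in_verts[of "fst e" "snd e"] adj_not_same[of "fst e"] by (cases e) auto
  next
    fix e assume "e \<in> {(u, v). (u, v) \<in> verts G \<times> verts G \<and> u \<noteq> v}"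
    then show "e \<in> arcs_ends G" using all by auto
  qed
  with assms show False by (simp add: complete_digraph_def)
qed

section \<open>Domination numbers\<close>

lemma domination_number_le:
  "finite X \<Longrightarrow> dominating_set G X \<Longrightarrow> \<gamma> G \<le> enat (card X)"
  unfolding domination_number_def by (rule INF_lower) simp

lemma total_domination_number_le:
  "finite S \<Longrightarrow> total_dominating_set G S \<Longrightarrow> \<gamma>\<^sub>t G \<le> enat (card S)"
  unfolding total_domination_number_def by (rule INF_lower) simp

lemma domination_number_attained:
  assumes "finite (verts G)"
  obtains X where "finite X" "dominating_set G X" "\<gamma> G = enat (card X)"
proof -
  let ?A = "(\<lambda>X. enat (card X)) ` {X. finite X \<and> dominating_set G X}"
  have "enat (card (verts G)) \<in> ?A"
    using assms by (auto simp: dominating_set_def)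
  then have "Inf ?A \<in> ?A"
    by (rule wellorder_InfI)
  then show thesis
    using that unfolding domination_number_def by auto
qed

section \<open>The upper bound\<close>

text \<open>
  The entries at \<open>i\<close> decide which \<open>d(i := x)\<close> a vertex \<open>v\<close> is near to, since at every other
  coordinate \<open>v\<close> is equal or adjacent to the dominating entry of \<open>d\<close>. Only a vertex that is itself
  this \<open>d(i := x)\<close> needs another neighbour, and \<open>d(j := y)\<close> is one: \<open>x\<close> is adjacent to \<open>d i\<close>, and
  \<open>d j\<close> is adjacent to \<open>y\<close>.
\<close>

lemma total_dominating_set_strong_product:
  assumes G: "\<And>k. k \<in> I \<Longrightarrow> graph (\<Gamma> k)"
    and ij: "i \<in> I" "j \<in> I" "i \<noteq> j"
    and d: "d \<in> (\<Pi>\<^sub>E k\<in>I. Dom (\<Gamma> k))"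
    and y: "y \<in> verts (\<Gamma> j) - Dom (\<Gamma> j)"
    and X: "dominating_set (\<Gamma> i \<setminus> Dom (\<Gamma> i)) X" "X \<noteq> {}"
  shows "total_dominating_set (strong_product I \<Gamma> \<setminus> (\<Pi>\<^sub>E k\<in>I. Dom (\<Gamma> k)))
    (insert (d(j := y)) ((\<lambda>x. d(i := x)) ` X))"
    (is "total_dominating_set (?P \<setminus> ?D) ?S")
proof -
  have XV: "x \<in> verts (\<Gamma> i) - Dom (\<Gamma> i)" if "x \<in> X" for x
    using X(1) that by (auto simp: dominating_set_def)
  have upd: "d(k := z) \<in> verts (?P \<setminus> ?D)" if "k \<in> I" "z \<in> verts (\<Gamma> k) - Dom (\<Gamma> k)" for k z
    using d that Dom_subset_verts by (fastforce simp: PiE_iff extensional_def)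
  have "\<exists>u\<in>?S. v \<rightarrow>\<^bsub>?P \<setminus> ?D\<^esub> u" if v: "v \<in> verts (?P \<setminus> ?D)" for v
  proof -
    have vk: "v k \<in> verts (\<Gamma> k)" if "k \<in> I" for k
      using v that by auto
    have dk: "d k \<in> Dom (\<Gamma> k)" if "k \<in> I" for k
      using d that by auto
    have near: "v k = d k \<or> v k \<rightarrow>\<^bsub>\<Gamma> k\<^esub> d k" if "k \<in> I" for k
      using eq_or_adj_Dom G dk vk that by metis
    obtain x where x: "x \<in> X" "v i = x \<or> v i \<rightarrow>\<^bsub>\<Gamma> i\<^esub> x"
    proof (cases "v i \<in> Dom (\<Gamma> i)")
      case True
      obtain x where x: "x \<in> X" using X(2) by blast
      have "x \<noteq> v i" using True XV[OF x] by blast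
      then have "v i \<rightarrow>\<^bsub>\<Gamma> i\<^esub> x"
        using adj_from_Dom[OF True] XV[OF x] by blast
      then show ?thesis using that x by blast
    next
      case False
      then have "v i \<in> verts (\<Gamma> i \<setminus> Dom (\<Gamma> i))" using vk ij(1) by simp
      then show ?thesis using X(1) that by (fastforce simp: dominating_set_def)
    qed
    show ?thesis
    proof (cases "v = d(i := x)")
      case True
      have "d j \<noteq> y"
        using dk[OF ij(2)] y by blast
      moreover from this have "d j \<rightarrow>\<^bsub>\<Gamma> j\<^esub> y"
        using adj_from_Dom[OF dk[OF ij(2)]] y by auto
      moreover have "v j = d j"
        using True ij(3) by simp
      ultimately have "v j \<noteq> y" "\<forall>k\<in>I. v k = (d(j := y)) k \<or> v k \<rightarrow>\<^bsub>\<Gamma> k\<^esub> (d(j := y)) k"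
        using near by simp_all
      moreover from this have "v \<noteq> d(j := y)"
        by auto
      ultimately have "v \<rightarrow>\<^bsub>?P \<setminus> ?D\<^esub> d(j := y)"
        using v upd[OF ij(2) y] by simp
      then show ?thesis by blast
    next
      case False
      have "\<forall>k\<in>I. v k = (d(i := x)) k \<or> v k \<rightarrow>\<^bsub>\<Gamma> k\<^esub> (d(i := x)) k"
        using near x(2) by simp
      then have "v \<rightarrow>\<^bsub>?P \<setminus> ?D\<^esub> d(i := x)"
        using False v upd[OF ij(1) XV[OF x(1)]] by simp
      then show ?thesis using x(1) by blast
    qed
  qed
  moreover have "?S \<subseteq> verts (?P \<setminus> ?D)"
    using upd ij y XV by blast
  ultimately show ?thesis
    by (simp add: total_dominating_set_def)
qed

lemma total_domination_number_strong_product_le: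
  assumes G: "\<And>k. k \<in> I \<Longrightarrow> graph (\<Gamma> k)"
    and ij: "i \<in> I" "j \<in> I" "i \<noteq> j"
    and D: "\<And>k. k \<in> I \<Longrightarrow> Dom (\<Gamma> k) \<noteq> {}"
    and V: "\<And>k. k \<in> I \<Longrightarrow> verts (\<Gamma> k) - Dom (\<Gamma> k) \<noteq> {}"
  shows "\<gamma>\<^sub>t (strong_product I \<Gamma> \<setminus> (\<Pi>\<^sub>E k\<in>I. Dom (\<Gamma> k))) \<le> \<gamma> (\<Gamma> i \<setminus> Dom (\<Gamma> i)) + 1"
proof -
  interpret graph "\<Gamma> i" using G ij(1) .
  obtain X where X: "finite X" "dominating_set (\<Gamma> i \<setminus> Dom (\<Gamma> i)) X"
      "\<gamma> (\<Gamma> i \<setminus> Dom (\<Gamma> i)) = enat (card X)"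
    by (rule domination_number_attained[of "\<Gamma> i \<setminus> Dom (\<Gamma> i)"]) simp_all
  have "X \<noteq> {}"
    using X(2) V[OF ij(1)] by (metis Diff_empty all_not_in_conv dominating_set_def verts_remove_verts)
  moreover obtain d where "d \<in> (\<Pi>\<^sub>E k\<in>I. Dom (\<Gamma> k))"
    using D by (metis PiE_eq_empty_iff all_not_in_conv)
  moreover obtain y where "y \<in> verts (\<Gamma> j) - Dom (\<Gamma> j)"
    using V[OF ij(2)] by blast
  ultimately have "\<gamma>\<^sub>t (strong_product I \<Gamma> \<setminus> (\<Pi>\<^sub>E k\<in>I. Dom (\<Gamma> k)))
      \<le> enat (card (insert (d(j := y)) ((\<lambda>x. d(i := x)) ` X)))"
    using X(1,2) ij G
    by (intro total_domination_number_le total_dominating_set_strong_product) auto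
  also have "\<dots> \<le> enat (card X + 1)"
    using card_image_le[OF X(1), of "\<lambda>x. d(i := x)"] X(1)
    by (simp add: card_insert_if)
  finally show ?thesis
    using X(3) by (simp add: one_enat_def)
qed

section \<open>The lower bound\<close>

text \<open>
  If the projection failed at every coordinate, the undominated vertices would assemble into one
  tuple. A neighbour of this tuple in \<open>S\<close> has an entry outside \<open>Dom\<close>, and there it dominates the
  vertex that was supposed to be undominated.
\<close>

lemma total_dominating_set_strong_product_projection:
  assumes "I \<noteq> {}"
    and S: "total_dominating_set (strong_product I \<Gamma> \<setminus> (\<Pi>\<^sub>E k\<in>I. Dom (\<Gamma> k))) S"
  shows "\<exists>i\<in>I. dominating_set (\<Gamma> i \<setminus> Dom (\<Gamma> i)) ((\<lambda>s. s i) ` S - Dom (\<Gamma> i))"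
proof (rule ccontr)
  let ?X = "\<lambda>i. (\<lambda>s. s i) ` S - Dom (\<Gamma> i)"
  assume contra: "\<not> ?thesis"
  have sub: "s \<in> (\<Pi>\<^sub>E k\<in>I. verts (\<Gamma> k)) - (\<Pi>\<^sub>E k\<in>I. Dom (\<Gamma> k))" if "s \<in> S" for s
    using S that by (auto simp: total_dominating_set_def)
  have "\<exists>v. v \<in> verts (\<Gamma> i) - Dom (\<Gamma> i) \<and> v \<notin> ?X i \<and> (\<forall>u\<in>?X i. \<not> v \<rightarrow>\<^bsub>\<Gamma> i\<^esub> u)"
    if i: "i \<in> I" for i
  proof -
    have "?X i \<subseteq> verts (\<Gamma> i \<setminus> Dom (\<Gamma> i))"
      using sub i by fastforce
    moreover have "\<not> dominating_set (\<Gamma> i \<setminus> Dom (\<Gamma> i)) (?X i)"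
      using contra i by blast
    ultimately obtain v where "v \<in> verts (\<Gamma> i \<setminus> Dom (\<Gamma> i)) - ?X i"
        "\<forall>u\<in>?X i. \<not> v \<rightarrow>\<^bsub>\<Gamma> i \<setminus> Dom (\<Gamma> i)\<^esub> u"
      unfolding dominating_set_def by blast
    then show ?thesis
      using \<open>?X i \<subseteq> _\<close> by (intro exI[of _ v]) auto
  qed
  then obtain v where v: "\<And>i. i \<in> I \<Longrightarrow> v i \<in> verts (\<Gamma> i) - Dom (\<Gamma> i)"
      "\<And>i. i \<in> I \<Longrightarrow> v i \<notin> ?X i" "\<And>i u. i \<in> I \<Longrightarrow> u \<in> ?X i \<Longrightarrow> \<not> v i \<rightarrow>\<^bsub>\<Gamma> i\<^esub> u"
    by metis
  have "restrict v I \<in> verts (strong_product I \<Gamma> \<setminus> (\<Pi>\<^sub>E k\<in>I. Dom (\<Gamma> k)))"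
    using v(1) assms(1) by (auto simp: PiE_iff)
  then obtain s where "s \<in> S"
      "restrict v I \<rightarrow>\<^bsub>strong_product I \<Gamma> \<setminus> (\<Pi>\<^sub>E k\<in>I. Dom (\<Gamma> k))\<^esub> s"
    using S unfolding total_dominating_set_def by blast
  then have s: "s \<in> S" "\<forall>i\<in>I. v i = s i \<or> v i \<rightarrow>\<^bsub>\<Gamma> i\<^esub> s i"
    by simp_all
  obtain i where "i \<in> I" "s i \<notin> Dom (\<Gamma> i)"
    using sub[OF s(1)] by (auto simp: PiE_iff)
  then have "s i \<in> ?X i" using s(1) by blast
  then show False
    using v(2,3) s(2) \<open>i \<in> I\<close> by metis
qed

text \<open>
  Only an entry \<open>s i\<close> of some \<open>s \<in> S\<close> could lack a neighbour. A neighbour of \<open>s\<close> in \<open>S\<close> is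
  different from \<open>s\<close>, so by injectivity it differs at \<open>i\<close> as well, and there it must be adjacent.
\<close>

lemma total_dominating_set_injective_projection:
  assumes i: "i \<in> I"
    and S: "total_dominating_set (strong_product I \<Gamma> \<setminus> (\<Pi>\<^sub>E k\<in>I. Dom (\<Gamma> k))) S"
    and inj: "inj_on (\<lambda>s. s i) S"
    and dom: "dominating_set (\<Gamma> i \<setminus> Dom (\<Gamma> i)) ((\<lambda>s. s i) ` S)"
  shows "total_dominating_set (\<Gamma> i \<setminus> Dom (\<Gamma> i)) ((\<lambda>s. s i) ` S)"
  unfolding total_dominating_set_def
proof (intro conjI ballI)
  show sub: "(\<lambda>s. s i) ` S \<subseteq> verts (\<Gamma> i \<setminus> Dom (\<Gamma> i))"
    using dom by (simp add: dominating_set_def)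
  fix v assume v: "v \<in> verts (\<Gamma> i \<setminus> Dom (\<Gamma> i))"
  show "\<exists>u\<in>(\<lambda>s. s i) ` S. v \<rightarrow>\<^bsub>\<Gamma> i \<setminus> Dom (\<Gamma> i)\<^esub> u"
  proof (cases "v \<in> (\<lambda>s. s i) ` S")
    case True
    then obtain s where s: "s \<in> S" "v = s i" by blast
    obtain s' where "s' \<in> S" "s \<rightarrow>\<^bsub>strong_product I \<Gamma> \<setminus> (\<Pi>\<^sub>E k\<in>I. Dom (\<Gamma> k))\<^esub> s'"
      using S s(1) unfolding total_dominating_set_def by blast
    then have s': "s' \<in> S" "s \<noteq> s'" "s i = s' i \<or> s i \<rightarrow>\<^bsub>\<Gamma> i\<^esub> s' i"
      using i by simp_all
    moreover have "s i \<noteq> s' i"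
      using inj s(1) s'(1,2) by (auto dest: inj_onD)
    ultimately have "v \<rightarrow>\<^bsub>\<Gamma> i \<setminus> Dom (\<Gamma> i)\<^esub> s' i"
      using s(2) sub v by auto
    then show ?thesis using s'(1) by blast
  next
    case False
    then show ?thesis using dom v by (simp add: dominating_set_def)
  qed
qed

lemma domination_number_plus_one_le_card:
  assumes "I \<noteq> {}" "finite S"
    and S: "total_dominating_set (strong_product I \<Gamma> \<setminus> (\<Pi>\<^sub>E k\<in>I. Dom (\<Gamma> k))) S"
    and gap: "\<And>i. i \<in> I \<Longrightarrow> \<gamma> (\<Gamma> i \<setminus> Dom (\<Gamma> i)) < \<gamma>\<^sub>t (\<Gamma> i \<setminus> Dom (\<Gamma> i))"
  shows "\<exists>i\<in>I. \<gamma> (\<Gamma> i \<setminus> Dom (\<Gamma> i)) + 1 \<le> enat (card S)"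
proof -
  obtain i where i: "i \<in> I"
      and dom: "dominating_set (\<Gamma> i \<setminus> Dom (\<Gamma> i)) ((\<lambda>s. s i) ` S - Dom (\<Gamma> i))"
      (is "dominating_set ?H ?X")
    using total_dominating_set_strong_product_projection[OF assms(1) S] by blast
  have le: "card ?X \<le> card ((\<lambda>s. s i) ` S)" "card ((\<lambda>s. s i) ` S) \<le> card S"
    using \<open>finite S\<close> by (simp_all add: card_mono card_image_le)
  have "\<gamma> ?H < enat (card S)"
  proof (cases "card ?X = card S")
    \<comment> \<open>Equal cardinalities mean that no entry lies in \<open>Dom\<close> and that no two entries coincide.\<close>
    case True
    then have "?X = (\<lambda>s. s i) ` S"
      using le \<open>finite S\<close> by (intro card_subset_eq) auto
    moreover have "inj_on (\<lambda>s. s i) S"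
      using True le \<open>finite S\<close> by (intro eq_card_imp_inj_on) auto
    ultimately have "total_dominating_set ?H ((\<lambda>s. s i) ` S)"
      using total_dominating_set_injective_projection[OF i S] dom by simp
    then have "\<gamma>\<^sub>t ?H \<le> enat (card ((\<lambda>s. s i) ` S))"
      using \<open>finite S\<close> by (intro total_domination_number_le) auto
    also have "\<dots> \<le> enat (card S)" using le(2) by simp
    finally show ?thesis using gap[OF i] by order
  next
    case False
    have "\<gamma> ?H \<le> enat (card ?X)"
      using \<open>finite S\<close> dom by (intro domination_number_le) auto
    also have "\<dots> < enat (card S)" using False le by simp
    finally show ?thesis .
  qed
  then show ?thesis
    using i ileI1 by (auto simp: eSuc_plus_1)
qed

theorem theorem1p6:
  fixes \<Gamma> :: "nat \<Rightarrow> ('a, 'b) pre_digraph" and t :: nat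
  assumes "t \<ge> 2"
    and "\<And>i. i \<in> {1..t} \<Longrightarrow> graph (\<Gamma> i)"
    and "\<And>i. i \<in> {1..t} \<Longrightarrow> \<not> K\<^bsub>card (verts (\<Gamma> i))\<^esub> (\<Gamma> i)"
    and "\<And>i. i \<in> {1..t} \<Longrightarrow> Dom (\<Gamma> i) \<noteq> {}"
  shows "\<gamma>\<^sub>t (strong_product {1..t} \<Gamma> \<setminus> (\<Pi>\<^sub>E i\<in>{1..t}. Dom (\<Gamma> i)))
           \<le> (MIN i\<in>{1..t}. \<gamma> (\<Gamma> i \<setminus> Dom (\<Gamma> i))) + 1
       \<and> ((\<forall>i\<in>{1..t}. \<gamma>\<^sub>t (\<Gamma> i \<setminus> Dom (\<Gamma> i)) > \<gamma> (\<Gamma> i \<setminus> Dom (\<Gamma> i))) \<longrightarrow>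
           \<gamma>\<^sub>t (strong_product {1..t} \<Gamma> \<setminus> (\<Pi>\<^sub>E i\<in>{1..t}. Dom (\<Gamma> i)))
             = (MIN i\<in>{1..t}. \<gamma> (\<Gamma> i \<setminus> Dom (\<Gamma> i))) + 1)"
proof -
  let ?I = "{1..t}" and ?g = "\<lambda>i. \<gamma> (\<Gamma> i \<setminus> Dom (\<Gamma> i))"
  let ?P = "strong_product ?I \<Gamma> \<setminus> (\<Pi>\<^sub>E i\<in>?I. Dom (\<Gamma> i))"
  have I: "?I \<noteq> {}" using assms(1) by simp
  have "Min (?g ` ?I) \<in> ?g ` ?I"
    using I by (intro Min_in) auto
  then obtain i where i: "i \<in> ?I" "Min (?g ` ?I) = ?g i" by auto
  obtain j where j: "j \<in> ?I" "i \<noteq> j"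
    using assms(1) by (cases "i = 1") (auto intro: that[of 1] that[of 2])
  have upper: "\<gamma>\<^sub>t ?P \<le> Min (?g ` ?I) + 1"
    unfolding i(2)
    by (rule total_domination_number_strong_product_le[OF assms(2) i(1) j assms(4)])
      (use assms(2,3) non_complete_imp_non_Dom in blast)+
  have "Min (?g ` ?I) + 1 \<le> \<gamma>\<^sub>t ?P" if gap: "\<forall>i\<in>?I. \<gamma>\<^sub>t (\<Gamma> i \<setminus> Dom (\<Gamma> i)) > ?g i"
    unfolding total_domination_number_def[of ?P]
  proof (rule INF_greatest)
    fix S assume "S \<in> {S. finite S \<and> total_dominating_set ?P S}"
    then obtain k where k: "k \<in> ?I" "?g k + 1 \<le> enat (card S)"
      using domination_number_plus_one_le_card[OF I, of S \<Gamma>] gap by blast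
    have "Min (?g ` ?I) \<le> ?g k" using k(1) by simp
    then show "Min (?g ` ?I) + 1 \<le> enat (card S)"
      using k(2) by (meson add_right_mono order_trans)
  qed
  with upper show ?thesis by (meson antisym)
qed

end
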